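(* Let $(\mathbf{X},\mathbf{A})\sim\mathrm{CSBM}(n,p,q,\boldsymbol{\mu},\sigma^2)$ with hidden classes $C_{-1},C_0,C_1$, where $p=p_n$, $q=q_n$, $\boldsymbol\mu=\boldsymbol\mu_n\in\mathbb{R}^{d}$ (with $d=d_n$) and $\sigma=\sigma_n$ may depend on $n$. Suppose that $p,q=\Omega(\log^2 n/n)$ and $\|\boldsymbol{\mu}\|_2=\omega(\sigma\sqrt{\log n})$. Then there exists a choice of attention architecture $\Psi$ such that, with probability at least $1-o_n(1)$ over the data $(\mathbf{X},\mathbf{A})$, the one-layer graph attention (GAT) estimator $$\hat{x}_i := \sum_{j\in N_i}\gamma_{ij}\,\tilde{\mathbf w}^{T}\mathbf{X}_j + b,\qquad \tilde{\mathbf w}=\boldsymbol{\mu}/\|\boldsymbol{\mu}\|,\quad b=-\|\boldsymbol{\mu}\|/2,$$ whose attention coefficients $\gamma_{ij}$ are obtained from $\Psi$ applied to the node features $\mathbf{X}_i,\mathbf{X}_j$, separates $C_0$ from $C_1\cup C_{-1}$: simultaneously for all $i\in[n]$, $\hat{x}_i<0$ if and only if $i\in C_0$.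
   Context: Data model $\mathrm{CSBM}(n,p,q,\boldsymbol\mu,\sigma^2)$ (contextual stochastic block model with three classes): $\epsilon_1,\dots,\epsilon_n$ are i.i.d. uniform on $\{-1,0,1\}$, and $C_k=\{j\in[n]:\epsilon_j=k\}$ for $k\in\{-1,0,1\}$. Given these, the feature vectors $\mathbf{X}_i\sim\mathcal{N}(\epsilon_i\boldsymbol\mu,\sigma^2\mathbf{I})$ in $\mathbb{R}^d$ are independent. Independently of the features given the classes, $\mathbf{A}=(a_{ij})\in\{0,1\}^{n\times n}$ is the random adjacency matrix of an undirected graph ($a_{ij}=a_{ji}$, independent otherwise) with $a_{ij}\sim\mathrm{Ber}(p)$ if $i,j$ are in the same class and $a_{ij}\sim\mathrm{Ber}(q)$ if they are in different classes, where $p,q\in[0,1]$. $N_i$ is the set of neighbours of node $i$ in the graph and $N_i^*=N_i\cup\{i\}$. An attention architecture (score function) is a function $\Psi$ assigning a real score to an ordered pair of feature vectors, of the form $\Psi(\mathbf h,\mathbf h')=\alpha(\mathbf{W}\mathbf h,\mathbf{W}\mathbf h')$ for a matrix $\mathbf W$ and a real-valued function $\alpha$ (e.g. a small neural network). It may depend on $n$ and the model parameters $(p,q,\boldsymbol\mu,\sigma)$ but not on the sampled data. The corresponding attention coefficients are $$\gamma_{ij}=\frac{\exp(\Psi(\mathbf{X}_i,\mathbf{X}_j))}{\sum_{\ell\in N_i^*}\exp(\Psi(\mathbf{X}_i,\mathbf{X}_\ell))}.$$ Asymptotic notation is as $n\to\infty$; $a_n=\omega(b_n)$ means that $a_n/b_n\to\infty$.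 *)

theory Defs
  imports "HOL-Probability.Probability" "HOL-Library.Landau_Symbols"
begin

text \<open>
  The feature dimension varies with the number of nodes, so a vector in \<open>d\<close>-dimensional space is a
  function \<open>nat \<Rightarrow> real\<close> of which only the coordinates below \<open>d\<close> are used. The nodes are
  \<open>0, \<dots>, n - 1\<close>, and the \<open>\<sigma>\<close> below is the standard deviation.
\<close>

type_synonym rvec = "nat \<Rightarrow> real"

definition vnorm :: "nat \<Rightarrow> rvec \<Rightarrow> real" where
  "vnorm d v = L2_set v {..<d}"

definition inner_prod :: "nat \<Rightarrow> rvec \<Rightarrow> rvec \<Rightarrow> real" where
  "inner_prod d v w = (\<Sum>k<d. v k * w k)"

definition mat_vec :: "nat \<Rightarrow> nat \<Rightarrow> (nat \<Rightarrow> nat \<Rightarrow> real) \<Rightarrow> rvec \<Rightarrow> rvec" where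
  "mat_vec m d W h = (\<lambda>r\<in>{..<m}. inner_prod d (W r) h)"


definition class_pmf :: "nat \<Rightarrow> (nat \<Rightarrow> int) pmf" where
  "class_pmf n = Pi_pmf {..<n} 0 (\<lambda>_. pmf_of_set {-1, 0, 1})"

definition community :: "nat \<Rightarrow> (nat \<Rightarrow> int) \<Rightarrow> int \<Rightarrow> nat set" where
  "community n \<epsilon> k = {j. j < n \<and> \<epsilon> j = k}"

text \<open>
  The normal distribution with mean \<open>m\<close> and covariance \<open>\<sigma>\<^sup>2 I\<close> is the product of its
  one-dimensional marginals.
\<close>

definition isotropic_normal :: "nat \<Rightarrow> rvec \<Rightarrow> real \<Rightarrow> rvec measure" where
  "isotropic_normal d m \<sigma> =
     (\<Pi>\<^sub>M k\<in>{..<d}. density lborel (\<lambda>x. ennreal (normal_density (m k) \<sigma> x)))"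

definition feature_measure ::
    "nat \<Rightarrow> nat \<Rightarrow> rvec \<Rightarrow> real \<Rightarrow> (nat \<Rightarrow> int) \<Rightarrow> (nat \<Rightarrow> rvec) measure" where
  "feature_measure n d \<mu> \<sigma> \<epsilon> =
     (\<Pi>\<^sub>M i\<in>{..<n}. isotropic_normal d (\<lambda>k. of_int (\<epsilon> i) * \<mu> k) \<sigma>)"

text \<open>
  One independent coin is tossed for each pair \<open>i < j\<close>; the adjacency matrix is the symmetric
  extension of the outcome. Coins outside the index set are constantly \<open>False\<close>, so there are no
  loops.
\<close>

definition adjacency_pmf ::
    "nat \<Rightarrow> real \<Rightarrow> real \<Rightarrow> (nat \<Rightarrow> int) \<Rightarrow> (nat \<Rightarrow> nat \<Rightarrow> bool) pmf" where
  "adjacency_pmf n p q \<epsilon> =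
     map_pmf (\<lambda>c i j. c (i, j) \<or> c (j, i))
       (Pi_pmf {(i, j). i < j \<and> j < n} False
         (\<lambda>(i, j). bernoulli_pmf (if \<epsilon> i = \<epsilon> j then p else q)))"

text \<open>
  The joint law of labels, features and adjacency matrix. Given the labels, features and adjacency
  matrix are independent.
\<close>

definition csbm ::
    "nat \<Rightarrow> nat \<Rightarrow> real \<Rightarrow> real \<Rightarrow> rvec \<Rightarrow> real \<Rightarrow>
      ((nat \<Rightarrow> int) \<times> (nat \<Rightarrow> rvec) \<times> (nat \<Rightarrow> nat \<Rightarrow> bool)) measure" where
  "csbm n d p q \<mu> \<sigma> =
     measure_pmf (class_pmf n) \<bind>
       (\<lambda>\<epsilon>. return (count_space UNIV) \<epsilon> \<Otimes>\<^sub>M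
             (feature_measure n d \<mu> \<sigma> \<epsilon> \<Otimes>\<^sub>M measure_pmf (adjacency_pmf n p q \<epsilon>)))"


definition neighbours :: "nat \<Rightarrow> (nat \<Rightarrow> nat \<Rightarrow> bool) \<Rightarrow> nat \<Rightarrow> nat set" where
  "neighbours n A i = {j. j < n \<and> A i j}"

definition attention_architecture :: "nat \<Rightarrow> (rvec \<Rightarrow> rvec \<Rightarrow> real) \<Rightarrow> bool" where
  "attention_architecture d \<Psi> \<longleftrightarrow>
     (\<exists>m W \<alpha>. \<forall>h h'. \<Psi> h h' = \<alpha> (mat_vec m d W h) (mat_vec m d W h'))"

definition attention_coeff ::
    "nat \<Rightarrow> (rvec \<Rightarrow> rvec \<Rightarrow> real) \<Rightarrow> (nat \<Rightarrow> rvec) \<Rightarrow> (nat \<Rightarrow> nat \<Rightarrow> bool) \<Rightarrow> nat \<Rightarrow> nat \<Rightarrow> real" where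
  "attention_coeff n \<Psi> X A i j =
     exp (\<Psi> (X i) (X j)) / (\<Sum>l\<in>insert i (neighbours n A i). exp (\<Psi> (X i) (X l)))"

definition gat_estimator ::
    "nat \<Rightarrow> nat \<Rightarrow> (rvec \<Rightarrow> rvec \<Rightarrow> real) \<Rightarrow> rvec \<Rightarrow> real \<Rightarrow>
      (nat \<Rightarrow> rvec) \<Rightarrow> (nat \<Rightarrow> nat \<Rightarrow> bool) \<Rightarrow> nat \<Rightarrow> real" where
  "gat_estimator n d \<Psi> w b X A i =
     (\<Sum>j\<in>neighbours n A i. attention_coeff n \<Psi> X A i j * inner_prod d w (X j)) + b"

end

theory Submission
  imports Defs "HOL-Real_Asymp.Real_Asymp"
begin

text \<open>
  The projections \<open>t\<^sub>i = \<langle>\<mu>, X\<^sub>i\<rangle> / \<parallel>\<mu>\<parallel>\<^sup>2\<close> are normal with mean \<open>\<epsilon>\<^sub>i\<close> and standard deviation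
  \<open>\<sigma> / \<parallel>\<mu>\<parallel> = o(1 / \<surd>(log n))\<close>, so with high probability all of them lie within \<open>1/10\<close> of their
  class label and the score can read off both classes. It makes a node of class \<open>0\<close> attend to
  class \<open>0\<close> and every other node attend to class \<open>1\<close>, with weight \<open>20 n\<close> against \<open>1\<close>. For a node of
  class \<open>0\<close> the estimator is then small because the node itself already fills the softmax
  denominator. For the others it is enough to have two neighbours of class \<open>1\<close>: one neighbour
  might only balance the node itself, which occurs in the denominator but not in the sum. Two such
  neighbours are found with high probability by looking for one in each half of the node set: a
  given half contains none with probability at most
  \<open>(1 - min p q / 3)\<^bsup>\<lfloor>n/2\<rfloor> - 1\<^esup> = exp (- \<Omega>(log\<^sup>2 n))\<close>, which survives the union bound over the nodes.
\<close>

section \<open>Gaussian tail bounds for projected features\<close>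

text \<open>Completing the square: tilting the density by \<open>exp (s * (x - m))\<close> moves its
  mean to \<open>m + s * \<sigma>\<^sup>2\<close> and leaves the constant
  \<open>exp (s\<^sup>2 * \<sigma>\<^sup>2 / 2)\<close>. This centred moment generating function
  feeds the Chernoff bound.\<close>

lemma nn_integral_normal_density_exp:
  fixes m s \<sigma> :: real
  assumes "\<sigma> > 0"
  shows "(\<integral>\<^sup>+x. ennreal (exp (s * (x - m))) \<partial>density lborel (\<lambda>x. ennreal (normal_density m \<sigma> x)))
    = ennreal (exp (s\<^sup>2 * \<sigma>\<^sup>2 / 2))"
proof -
  have shift: "normal_density m \<sigma> x * exp (s * (x - m)) =
      exp (s\<^sup>2 * \<sigma>\<^sup>2 / 2) * normal_density (m + s * \<sigma>\<^sup>2) \<sigma> x" for x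
  proof -
    have "- (x - m)\<^sup>2 / (2 * \<sigma>\<^sup>2) + s * (x - m) =
        s\<^sup>2 * \<sigma>\<^sup>2 / 2 + - (x - (m + s * \<sigma>\<^sup>2))\<^sup>2 / (2 * \<sigma>\<^sup>2)"
      using assms by (simp add: field_simps power2_eq_square)
    then have "exp (- (x - m)\<^sup>2 / (2 * \<sigma>\<^sup>2)) * exp (s * (x - m)) =
        exp (s\<^sup>2 * \<sigma>\<^sup>2 / 2) * exp (- (x - (m + s * \<sigma>\<^sup>2))\<^sup>2 / (2 * \<sigma>\<^sup>2))"
      by (simp only: exp_add [symmetric])
    then show ?thesis
      by (simp add: normal_density_def)
  qed
  have "(\<integral>\<^sup>+x. ennreal (exp (s * (x - m))) \<partial>density lborel (\<lambda>x. ennreal (normal_density m \<sigma> x)))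
      = (\<integral>\<^sup>+x. ennreal (normal_density m \<sigma> x * exp (s * (x - m))) \<partial>lborel)"
    by (subst nn_integral_density) (auto simp: ennreal_mult')
  also have "\<dots> = ennreal (exp (s\<^sup>2 * \<sigma>\<^sup>2 / 2)) *
      (\<integral>\<^sup>+x. ennreal (normal_density (m + s * \<sigma>\<^sup>2) \<sigma> x) \<partial>lborel)"
    by (simp add: shift ennreal_mult' nn_integral_cmult)
  also have "(\<integral>\<^sup>+x. ennreal (normal_density (m + s * \<sigma>\<^sup>2) \<sigma> x) \<partial>lborel) = 1"
    using assms by (subst nn_integral_eq_integral) (auto simp: normal_density_nonneg)
  finally show ?thesis by simp
qed

lemma sets_isotropic_normal [measurable_cong]:
  "sets (isotropic_normal d m \<sigma>) = sets (Pi\<^sub>M {..<d} (\<lambda>_. borel))"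
  unfolding isotropic_normal_def by (intro sets_PiM_cong) auto

lemma prob_space_isotropic_normal:
  "\<sigma> > 0 \<Longrightarrow> prob_space (isotropic_normal d m \<sigma>)"
  unfolding isotropic_normal_def by (intro prob_space_PiM prob_space_normal_density)

lemma sets_feature_measure [measurable_cong]:
  "sets (feature_measure n d \<mu> \<sigma> \<epsilon>) = sets (Pi\<^sub>M {..<n} (\<lambda>_. Pi\<^sub>M {..<d} (\<lambda>_. borel)))"
  unfolding feature_measure_def by (intro sets_PiM_cong sets_isotropic_normal refl)

lemma prob_space_feature_measure:
  "\<sigma> > 0 \<Longrightarrow> prob_space (feature_measure n d \<mu> \<sigma> \<epsilon>)"
  unfolding feature_measure_def by (intro prob_space_PiM prob_space_isotropic_normal)

lemma measurable_inner_prod [measurable]: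
  "inner_prod d a \<in> borel_measurable (Pi\<^sub>M {..<d} (\<lambda>_. borel))"
  unfolding inner_prod_def [abs_def] by measurable

text \<open>Chernoff's method: the coordinates are independent, so the moment generating function of
  the centred projection factorises into that of a normal variable with variance
  \<open>\<sigma>\<^sup>2 * (vnorm d a)\<^sup>2\<close>.\<close>

lemma isotropic_normal_upper_tail:
  fixes a m :: rvec
  assumes "\<sigma> > 0" "c > 0" "vnorm d a > 0"
  shows "emeasure (isotropic_normal d m \<sigma>)
      {x \<in> space (isotropic_normal d m \<sigma>). inner_prod d a x - inner_prod d a m \<ge> c}
    \<le> ennreal (exp (- c\<^sup>2 / (2 * \<sigma>\<^sup>2 * (vnorm d a)\<^sup>2)))"
proof -
  let ?M = "isotropic_normal d m \<sigma>"
  define V where "V = (vnorm d a)\<^sup>2"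
  have V: "V > 0" "V = (\<Sum>k<d. (a k)\<^sup>2)"
    using assms by (auto simp: V_def vnorm_def L2_set_def sum_nonneg)
  \<comment> \<open>This \<open>s\<close> minimises the Chernoff exponent
    \<open>- s * c + s\<^sup>2 * \<sigma>\<^sup>2 * V / 2\<close>.\<close>
  define s where "s = c / (\<sigma>\<^sup>2 * V)"
  have s: "s > 0" using assms V by (simp add: s_def)
  interpret P: prob_space "density lborel (\<lambda>x. ennreal (normal_density (m k) \<sigma> x))" for k
    using assms(1) by (rule prob_space_normal_density)
  interpret product_sigma_finite "\<lambda>k. density lborel (\<lambda>x. ennreal (normal_density (m k) \<sigma> x))" ..
  have "(\<integral>\<^sup>+x. ennreal (exp (s * (inner_prod d a x - inner_prod d a m))) \<partial>?M)
      = (\<integral>\<^sup>+x. (\<Prod>k<d. ennreal (exp (s * a k * (x k - m k)))) \<partial>?M)"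
    by (intro nn_integral_cong)
      (simp add: inner_prod_def prod_ennreal exp_sum [symmetric] sum_subtractf [symmetric]
        sum_distrib_left algebra_simps)
  also have "\<dots> = (\<Prod>k<d. \<integral>\<^sup>+x. ennreal (exp (s * a k * (x - m k)))
      \<partial>density lborel (\<lambda>x. ennreal (normal_density (m k) \<sigma> x)))"
    unfolding isotropic_normal_def by (intro product_nn_integral_prod) auto
  also have "\<dots> = ennreal (\<Prod>k<d. exp ((s * a k)\<^sup>2 * \<sigma>\<^sup>2 / 2))"
    using assms by (simp add: nn_integral_normal_density_exp prod_ennreal)
  also have "(\<Prod>k<d. exp ((s * a k)\<^sup>2 * \<sigma>\<^sup>2 / 2)) = exp (s\<^sup>2 * \<sigma>\<^sup>2 * V / 2)"
    by (simp add: exp_sum [symmetric] V(2) sum_distrib_left sum_divide_distrib power_mult_distrib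
        algebra_simps)
  finally have mgf: "(\<integral>\<^sup>+x. ennreal (exp (s * (inner_prod d a x - inner_prod d a m))) \<partial>?M)
      = ennreal (exp (s\<^sup>2 * \<sigma>\<^sup>2 * V / 2))" .
  have "emeasure ?M {x \<in> space ?M. inner_prod d a x - inner_prod d a m \<ge> c}
      \<le> ennreal (exp (- s * c)) *
      (\<integral>\<^sup>+x. ennreal (exp (s * (inner_prod d a x - inner_prod d a m))) * indicator (space ?M) x \<partial>?M)"
    using s by (intro Chernoff_ineq_nn_integral_ge) measurable
  also have "\<dots> = ennreal (exp (- (s * c))) * ennreal (exp (s\<^sup>2 * \<sigma>\<^sup>2 * V / 2))"
    unfolding mgf [symmetric] by (intro arg_cong2 [where f = "(*)"] refl nn_integral_cong) auto
  also have "\<dots> = ennreal (exp (- (s * c) + s\<^sup>2 * \<sigma>\<^sup>2 * V / 2))"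
    by (simp add: ennreal_mult' [symmetric] exp_add [symmetric])
  also have "- (s * c) + s\<^sup>2 * \<sigma>\<^sup>2 * V / 2 = - c\<^sup>2 / (2 * \<sigma>\<^sup>2 * V)"
    using assms V(1) by (simp add: s_def field_simps power2_eq_square)
  finally show ?thesis by (simp add: V_def)
qed

text \<open>The lower tail in direction \<open>a\<close> is the upper tail in direction
  \<open>- a\<close>, which has the same norm; the factor 2 is the union bound.\<close>

lemma isotropic_normal_tail:
  fixes a m :: rvec
  assumes "\<sigma> > 0" "c > 0" "vnorm d a > 0"
  shows "emeasure (isotropic_normal d m \<sigma>)
      {x \<in> space (isotropic_normal d m \<sigma>). \<bar>inner_prod d a x - inner_prod d a m\<bar> \<ge> c}
    \<le> ennreal (2 * exp (- c\<^sup>2 / (2 * \<sigma>\<^sup>2 * (vnorm d a)\<^sup>2)))"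
proof -
  let ?M = "isotropic_normal d m \<sigma>"
  let ?S = "\<lambda>a. {x \<in> space ?M. inner_prod d a x - inner_prod d a m \<ge> c}"
  let ?e = "exp (- c\<^sup>2 / (2 * \<sigma>\<^sup>2 * (vnorm d a)\<^sup>2))"
  have neg: "inner_prod d (\<lambda>k. - a k) x = - inner_prod d a x" for x
    by (simp add: inner_prod_def sum_negf)
  have vneg: "vnorm d (\<lambda>k. - a k) = vnorm d a"
    by (simp add: vnorm_def L2_set_def)
  have "{x \<in> space ?M. \<bar>inner_prod d a x - inner_prod d a m\<bar> \<ge> c} = ?S a \<union> ?S (\<lambda>k. - a k)"
    by (auto simp: neg)
  then have "emeasure ?M {x \<in> space ?M. \<bar>inner_prod d a x - inner_prod d a m\<bar> \<ge> c}
      \<le> emeasure ?M (?S a) + emeasure ?M (?S (\<lambda>k. - a k))"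
    by (simp only:) (intro emeasure_subadditive; measurable)
  also have "\<dots> \<le> ennreal ?e + ennreal ?e"
    using isotropic_normal_upper_tail [OF assms, of m]
      isotropic_normal_upper_tail [of \<sigma> c d "\<lambda>k. - a k" m] assms
    by (intro add_mono) (simp_all add: vneg)
  also have "\<dots> = ennreal (2 * ?e)"
    by (simp flip: ennreal_plus)
  finally show ?thesis .
qed

text \<open>Dividing \<mu> by its squared norm gives a direction \<open>w\<close> along which a
  node's mean is exactly its label, while the norm of \<open>w\<close> is the reciprocal of that of
  \<mu>. The one-node tail bound is then summed over the nodes.\<close>

lemma feature_measure_tail:
  fixes \<mu> :: rvec
  assumes "\<sigma> > 0" "c > 0" "vnorm d \<mu> > 0"
  defines "w \<equiv> \<lambda>k. \<mu> k / (vnorm d \<mu>)\<^sup>2"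
  shows "emeasure (feature_measure n d \<mu> \<sigma> \<epsilon>)
      {X \<in> space (feature_measure n d \<mu> \<sigma> \<epsilon>). \<exists>i<n. \<bar>inner_prod d w (X i) - of_int (\<epsilon> i)\<bar> \<ge> c}
    \<le> ennreal (2 * real n * exp (- c\<^sup>2 * (vnorm d \<mu>)\<^sup>2 / (2 * \<sigma>\<^sup>2)))"
proof -
  let ?F = "feature_measure n d \<mu> \<sigma> \<epsilon>"
  let ?N = "\<lambda>i. isotropic_normal d (\<lambda>k. of_int (\<epsilon> i) * \<mu> k) \<sigma>"
  let ?B = "\<lambda>i. {X \<in> space ?F. \<bar>inner_prod d w (X i) - of_int (\<epsilon> i)\<bar> \<ge> c}"
  let ?e = "exp (- c\<^sup>2 * (vnorm d \<mu>)\<^sup>2 / (2 * \<sigma>\<^sup>2))"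
  have norm2: "(vnorm d \<mu>)\<^sup>2 = (\<Sum>k<d. (\<mu> k)\<^sup>2)"
    by (simp add: vnorm_def L2_set_def sum_nonneg)
  have "(vnorm d w)\<^sup>2 = (\<Sum>k<d. (\<mu> k)\<^sup>2) / ((vnorm d \<mu>)\<^sup>2)\<^sup>2"
    by (subst vnorm_def)
      (simp add: L2_set_def sum_nonneg w_def power_divide sum_divide_distrib)
  then have w2: "(vnorm d w)\<^sup>2 = 1 / (vnorm d \<mu>)\<^sup>2"
    using assms(3) unfolding norm2 [symmetric] by (simp add: power2_eq_square)
  then have w: "vnorm d w > 0"
    using assms(3) L2_set_nonneg [of w "{..<d}"] by (fastforce simp: vnorm_def less_le)
  have mean: "inner_prod d w (\<lambda>k. of_int z * \<mu> k) = of_int z" for z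
  proof -
    have "inner_prod d w (\<lambda>k. of_int z * \<mu> k) = of_int z * ((\<Sum>k<d. (\<mu> k)\<^sup>2) / (vnorm d \<mu>)\<^sup>2)"
      by (simp add: inner_prod_def w_def sum_distrib_left sum_divide_distrib power2_eq_square
          algebra_simps)
    then show ?thesis using assms(3) by (simp add: norm2 [symmetric])
  qed
  \<comment> \<open>The feature vector of node \<open>i\<close> is a marginal of the product
    measure, so the tail bound for a single vector transfers.\<close>
  have node: "emeasure ?F (?B i) \<le> ennreal (2 * ?e)" if i: "i < n" for i
  proof -
    have "distr ?F (?N i) (\<lambda>X. X i) = ?N i"
      unfolding feature_measure_def using i assms
      by (intro distr_PiM_component prob_space_isotropic_normal) auto
    then have "emeasure (?N i) {x \<in> space (?N i). \<bar>inner_prod d w x - of_int (\<epsilon> i)\<bar> \<ge> c}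
        = emeasure (distr ?F (?N i) (\<lambda>X. X i))
            {x \<in> space (?N i). \<bar>inner_prod d w x - of_int (\<epsilon> i)\<bar> \<ge> c}"
      by simp
    also have "\<dots> = emeasure ?F ((\<lambda>X. X i) -` {x \<in> space (?N i). \<bar>inner_prod d w x - of_int (\<epsilon> i)\<bar> \<ge> c}
        \<inter> space ?F)"
    proof (rule emeasure_distr)
      show "(\<lambda>X. X i) \<in> ?F \<rightarrow>\<^sub>M ?N i"
        unfolding feature_measure_def using i by (intro measurable_component_singleton) auto
    qed measurable
    also have "(\<lambda>X. X i) -` {x \<in> space (?N i). \<bar>inner_prod d w x - of_int (\<epsilon> i)\<bar> \<ge> c} \<inter> space ?F = ?B i"
      using i by (auto simp: feature_measure_def space_PiM PiE_def Pi_def)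
    finally show ?thesis
      using isotropic_normal_tail [OF assms(1,2) w, of "\<lambda>k. of_int (\<epsilon> i) * \<mu> k"]
      by (simp add: mean w2)
  qed
  have "{X \<in> space ?F. \<exists>i<n. \<bar>inner_prod d w (X i) - of_int (\<epsilon> i)\<bar> \<ge> c} = (\<Union>i\<in>{..<n}. ?B i)"
    by auto
  then have "emeasure ?F {X \<in> space ?F. \<exists>i<n. \<bar>inner_prod d w (X i) - of_int (\<epsilon> i)\<bar> \<ge> c}
      = emeasure ?F (\<Union>i\<in>{..<n}. ?B i)"
    by (rule arg_cong)
  also have "\<dots> \<le> (\<Sum>i<n. emeasure ?F (?B i))"
    by (intro emeasure_subadditive_finite) (auto simp: image_subset_iff)
  also have "\<dots> \<le> (\<Sum>i<n. ennreal (2 * ?e))"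
    by (intro sum_mono node) auto
  also have "\<dots> = ennreal (2 * real n * ?e)"
    by (simp add: ennreal_of_nat_eq_real_of_nat ennreal_mult' [symmetric] algebra_simps)
  finally show ?thesis .
qed

section \<open>Neighbours of class 1 in the random graph\<close>

text \<open>Distinct \<open>j\<close> in \<open>H\<close> use distinct, hence independent, coins,
  and each fails with probability at most \<open>1 - r\<close>, whichever of \<open>p\<close> and
  \<open>q\<close> governs it.\<close>

lemma adjacency_pmf_no_edges:
  fixes i n :: nat and H :: "nat set"
  assumes "i < n" "H \<subseteq> {..<n} - {i}"
    and r: "0 \<le> r" "r \<le> p" "r \<le> q" "p \<le> 1" "q \<le> 1"
  shows "measure_pmf.prob (adjacency_pmf n p q \<epsilon>) {A. \<forall>j\<in>H. \<not> A i j} \<le> (1 - r) ^ card H"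
proof -
  define E where "E = {(i, j). i < j \<and> j < n}"
  \<comment> \<open>\<open>e j\<close> is the increasing pair under which the coin for
    \<open>i\<close> and \<open>j\<close> is stored; it lies in \<open>E\<close> because
    \<open>i\<close> is not in \<open>H\<close>.\<close>
  define e where "e j = (min i j, max i j)" for j
  define B where "B x = (if x \<in> e ` H then {False} else UNIV)" for x
  define b where "b = (\<lambda>(i, j). bernoulli_pmf (if \<epsilon> i = \<epsilon> j then p else q))"
  have "E \<subseteq> {..<n} \<times> {..<n}"
    by (auto simp: E_def)
  then have E: "finite E"
    by (rule finite_subset) auto
  have H: "finite H"
    using assms(2) by (rule finite_subset) auto
  have eE: "e ` H \<subseteq> E"
    using assms(1,2) by (force simp: e_def E_def min_def max_def)
  have inj: "inj_on e H"
    by (auto simp: inj_on_def e_def min_def max_def split: if_splits)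
  have "measure_pmf.prob (adjacency_pmf n p q \<epsilon>) {A. \<forall>j\<in>H. \<not> A i j}
      = measure_pmf.prob (Pi_pmf E False b) {c. \<forall>j\<in>H. \<not> (c (i, j) \<or> c (j, i))}"
    by (simp add: adjacency_pmf_def E_def b_def vimage_def)
  \<comment> \<open>Inclusion is enough here: only the correctly ordered coin of each pair is kept,
    and the event becomes a product set.\<close>
  also have "\<dots> \<le> measure_pmf.prob (Pi_pmf E False b) (Pi E B)"
    by (intro measure_pmf.finite_measure_mono)
      (auto simp: B_def e_def min_def max_def split: if_splits)
  also have "\<dots> = (\<Prod>x\<in>E. measure_pmf.prob (b x) (B x))"
    using E by (rule measure_Pi_pmf_Pi)
  also have "\<dots> = (\<Prod>x\<in>e ` H. measure_pmf.prob (b x) (B x))"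
    using E eE by (intro prod.mono_neutral_right) (auto simp: B_def)
  also have "\<dots> \<le> (\<Prod>x\<in>e ` H. 1 - r)"
  proof (intro prod_mono conjI measure_nonneg)
    fix x assume "x \<in> e ` H"
    then show "measure_pmf.prob (b x) (B x) \<le> 1 - r"
      using r by (cases x) (auto simp: B_def b_def measure_pmf_single)
  qed
  also have "\<dots> = (1 - r) ^ card H"
    by (simp add: card_image inj)
  finally show ?thesis .
qed

text \<open>The power is a product of independent factors, one per node of \<open>H\<close>. Such a
  node has label 1 with probability 1/3, so its factor has mean
  \<open>2/3 + (1 - r) / 3 = 1 - r / 3\<close>.\<close>

lemma nn_integral_class_pmf_power:
  fixes r :: real
  assumes "H \<subseteq> {..<n}" "0 \<le> r" "r \<le> 1"
  shows "(\<integral>\<^sup>+\<epsilon>. ennreal ((1 - r) ^ card {j\<in>H. \<epsilon> j = 1}) \<partial>measure_pmf (class_pmf n))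
    = ennreal ((1 - r / 3) ^ card H)"
proof -
  define f where "f j v = (if j \<in> H \<and> v = (1::int) then ennreal (1 - r) else 1)" for j :: nat and v
  have H: "finite H"
    using assms(1) by (rule finite_subset) auto
  have "ennreal ((1 - r) ^ card {j\<in>H. \<epsilon> j = 1}) = (\<Prod>j<n. f j (\<epsilon> j))" for \<epsilon>
  proof -
    have "(\<Prod>j<n. f j (\<epsilon> j)) = (\<Prod>j\<in>{j\<in>H. \<epsilon> j = 1}. f j (\<epsilon> j))"
      using assms(1) by (intro prod.mono_neutral_right) (auto simp: f_def)
    also have "\<dots> = (\<Prod>j\<in>{j\<in>H. \<epsilon> j = 1}. ennreal (1 - r))"
      by (intro prod.cong) (auto simp: f_def)
    finally show ?thesis
      using assms by (simp add: ennreal_power)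
  qed
  then have "(\<integral>\<^sup>+\<epsilon>. ennreal ((1 - r) ^ card {j\<in>H. \<epsilon> j = 1}) \<partial>measure_pmf (class_pmf n))
      = (\<Prod>j<n. \<integral>\<^sup>+v. f j v \<partial>measure_pmf (pmf_of_set {-1, 0, 1}))"
    by (simp add: class_pmf_def nn_integral_prod_Pi_pmf)
  also have "\<dots> = (\<Prod>j\<in>H. \<integral>\<^sup>+v. f j v \<partial>measure_pmf (pmf_of_set {-1, 0, 1}))"
    using assms(1) by (intro prod.mono_neutral_right) (auto simp: f_def measure_pmf.emeasure_space_1)
  also have "\<dots> = (\<Prod>j\<in>H. ennreal (1 - r / 3))"
  proof (intro prod.cong refl)
    fix j assume "j \<in> H"
    then have "(\<integral>\<^sup>+v. f j v \<partial>measure_pmf (pmf_of_set {-1, 0, 1}))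
        = (\<integral>\<^sup>+v. ennreal (if v = 1 then 1 - r else 1) \<partial>measure_pmf (pmf_of_set {-1, 0, 1::int}))"
      by (intro nn_integral_cong) (auto simp: f_def)
    also have "\<dots> = ennreal (measure_pmf.expectation (pmf_of_set {-1, 0, 1::int})
        (\<lambda>v. if v = 1 then 1 - r else 1))"
      using assms by (intro nn_integral_eq_integral integrable_measure_pmf_finite) auto
    also have "measure_pmf.expectation (pmf_of_set {-1, 0, 1::int})
        (\<lambda>v. if v = 1 then 1 - r else 1) = 1 - r / 3"
      by (subst integral_pmf_of_set) (auto simp: field_simps)
    finally show "(\<integral>\<^sup>+v. f j v \<partial>measure_pmf (pmf_of_set {-1, 0, 1})) = ennreal (1 - r / 3)" .
  qed
  also have "\<dots> = ennreal ((1 - r / 3) ^ card H)"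
    using assms by (simp add: ennreal_power)
  finally show ?thesis .
qed

text \<open>Union bound over the pairs of a node \<open>i\<close> and a half \<open>H\<close>. For
  fixed labels the probability of no hit is at most \<open>1 - r\<close> to the number of class 1
  nodes in \<open>H - {i}\<close>; averaging this over the labels turns the base into
  \<open>1 - r / 3\<close>.\<close>

lemma adjacency_pmf_no_hit:
  fixes n :: nat
  assumes r: "0 \<le> r" "r \<le> p" "r \<le> q" "p \<le> 1" "q \<le> 1"
  shows "(\<integral>\<^sup>+\<epsilon>. emeasure (measure_pmf (adjacency_pmf n p q \<epsilon>))
      {A. \<exists>i<n. \<exists>H\<in>{{..<n div 2}, {n div 2..<n}}. \<forall>j\<in>H - {i}. \<epsilon> j = 1 \<longrightarrow> \<not> A i j}
      \<partial>measure_pmf (class_pmf n))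
    \<le> ennreal (2 * real n * (1 - r / 3) ^ (n div 2 - 1))"
proof -
  let ?H = "{{..<n div 2}, {n div 2..<n}}"
  let ?S = "\<lambda>\<epsilon> i H. {j\<in>H - {i}. \<epsilon> j = (1::int)}"
  have sub: "H \<subseteq> {..<n} \<and> n div 2 \<le> card H" if "H \<in> ?H" for H
    using that by auto
  have node: "emeasure (measure_pmf (adjacency_pmf n p q \<epsilon>)) {A. \<forall>j\<in>H - {i}. \<epsilon> j = 1 \<longrightarrow> \<not> A i j}
      \<le> ennreal ((1 - r) ^ card (?S \<epsilon> i H))" if "i < n" "H \<in> ?H" for \<epsilon> i H
  proof -
    have "{A. \<forall>j\<in>H - {i}. \<epsilon> j = 1 \<longrightarrow> \<not> A i j} = {A. \<forall>j\<in>?S \<epsilon> i H. \<not> A i j}"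
      by auto
    moreover have "measure_pmf.prob (adjacency_pmf n p q \<epsilon>) {A. \<forall>j\<in>?S \<epsilon> i H. \<not> A i j}
        \<le> (1 - r) ^ card (?S \<epsilon> i H)"
      using sub [OF that(2)] that(1) r by (intro adjacency_pmf_no_edges) auto
    ultimately show ?thesis
      by (simp add: measure_pmf.emeasure_eq_measure ennreal_leI)
  qed
  have mean: "(\<integral>\<^sup>+\<epsilon>. ennreal ((1 - r) ^ card (?S \<epsilon> i H)) \<partial>measure_pmf (class_pmf n))
      \<le> ennreal ((1 - r / 3) ^ (n div 2 - 1))" if "H \<in> ?H" for i H
  proof -
    have "finite H"
      using that by auto
    \<comment> \<open>Each half has at least \<open>n div 2\<close> nodes, and one of them may be
      \<open>i\<close> itself, hence the exponent \<open>n div 2 - 1\<close>.\<close>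
    then have "card H - 1 \<le> card (H - {i})"
      by (simp add: card_Diff_singleton_if)
    then have "n div 2 - 1 \<le> card (H - {i})"
      using sub [OF that] by linarith
    then have "(1 - r / 3) ^ card (H - {i}) \<le> (1 - r / 3) ^ (n div 2 - 1)"
      using r by (intro power_decreasing) auto
    then show ?thesis
      using sub [OF that] r by (subst nn_integral_class_pmf_power) (auto intro: ennreal_leI)
  qed
  have "emeasure (measure_pmf (adjacency_pmf n p q \<epsilon>))
      {A. \<exists>i<n. \<exists>H\<in>?H. \<forall>j\<in>H - {i}. \<epsilon> j = 1 \<longrightarrow> \<not> A i j}
    \<le> (\<Sum>(i, H)\<in>{..<n} \<times> ?H. ennreal ((1 - r) ^ card (?S \<epsilon> i H)))" for \<epsilon>
  proof -
    let ?A = "measure_pmf (adjacency_pmf n p q \<epsilon>)"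
    let ?X = "\<lambda>(i, H). {A. \<forall>j\<in>H - {i}. \<epsilon> j = 1 \<longrightarrow> \<not> A i j}"
    have "{A. \<exists>i<n. \<exists>H\<in>?H. \<forall>j\<in>H - {i}. \<epsilon> j = 1 \<longrightarrow> \<not> A i j} = (\<Union>x\<in>{..<n} \<times> ?H. ?X x)"
      by auto
    then have "emeasure ?A {A. \<exists>i<n. \<exists>H\<in>?H. \<forall>j\<in>H - {i}. \<epsilon> j = 1 \<longrightarrow> \<not> A i j}
        = emeasure ?A (\<Union>x\<in>{..<n} \<times> ?H. ?X x)"
      by (rule arg_cong)
    also have "\<dots> \<le> (\<Sum>x\<in>{..<n} \<times> ?H. emeasure ?A (?X x))"
      by (intro emeasure_subadditive_finite) auto
    also have "\<dots> \<le> (\<Sum>(i, H)\<in>{..<n} \<times> ?H. ennreal ((1 - r) ^ card (?S \<epsilon> i H)))"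
    proof (intro sum_mono)
      fix x assume "x \<in> {..<n} \<times> ?H"
      then show "emeasure ?A (?X x) \<le> (case x of (i, H) \<Rightarrow> ennreal ((1 - r) ^ card (?S \<epsilon> i H)))"
        using node [of "fst x" "snd x" \<epsilon>] by (simp only: case_prod_beta mem_Times_iff lessThan_iff)
    qed
    finally show ?thesis .
  qed
  then have "(\<integral>\<^sup>+\<epsilon>. emeasure (measure_pmf (adjacency_pmf n p q \<epsilon>))
      {A. \<exists>i<n. \<exists>H\<in>?H. \<forall>j\<in>H - {i}. \<epsilon> j = 1 \<longrightarrow> \<not> A i j} \<partial>measure_pmf (class_pmf n))
    \<le> (\<integral>\<^sup>+\<epsilon>. (\<Sum>(i, H)\<in>{..<n} \<times> ?H. ennreal ((1 - r) ^ card (?S \<epsilon> i H)))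
        \<partial>measure_pmf (class_pmf n))"
    by (intro nn_integral_mono)
  also have "\<dots> = (\<Sum>(i, H)\<in>{..<n} \<times> ?H.
      \<integral>\<^sup>+\<epsilon>. ennreal ((1 - r) ^ card (?S \<epsilon> i H)) \<partial>measure_pmf (class_pmf n))"
    unfolding case_prod_beta by (rule nn_integral_sum) auto
  also have "\<dots> \<le> (\<Sum>(i, H)\<in>{..<n} \<times> ?H. ennreal ((1 - r / 3) ^ (n div 2 - 1)))"
    unfolding case_prod_beta by (intro sum_mono mean) (simp add: mem_Times_iff)
  also have "\<dots> = ennreal (real (n * card ?H) * (1 - r / 3) ^ (n div 2 - 1))"
    using r by (simp add: case_prod_beta card_cartesian_product ennreal_of_nat_eq_real_of_nat
        ennreal_mult' [symmetric] del: of_nat_mult)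
  also have "\<dots> \<le> ennreal (2 * real n * (1 - r / 3) ^ (n div 2 - 1))"
  proof (intro ennreal_leI mult_right_mono)
    \<comment> \<open>Only an upper bound holds in general: for \<open>n = 0\<close> both halves are
      empty and coincide.\<close>
    have "card ?H \<le> 2"
      by (simp add: card_insert_if)
    then have "n * card ?H \<le> n * 2"
      by (rule mult_le_mono2)
    then show "real (n * card ?H) \<le> 2 * real n"
      by linarith
  qed (use r in simp)
  finally show ?thesis .
qed

section \<open>The attention score and deterministic separation\<close>

text \<open>\<open>a\<close> is the projection of the attending node and \<open>b\<close> that of
  the attended one. The thresholds at 1/2 recover the labels as long as every projection is within
  less than 1/2 of its label.\<close>

definition class_score :: "real \<Rightarrow> real \<Rightarrow> real \<Rightarrow> real" where
  "class_score R a b = (if (if \<bar>a\<bar> < 1/2 then \<bar>b\<bar> < 1/2 else b \<ge> 1/2) then R else 0)"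

text \<open>The deterministic core, in units where the class means are -1, 0 and 1: all weights are
  \<open>E = 20 * real n\<close> or 1, so up to \<open>n\<close> unwanted neighbours weigh together
  at most \<open>E / 20\<close>. For a node outside class 0 the two hits outweigh both these
  neighbours and the node's own share of the denominator.\<close>

lemma class_score_attention:
  fixes t :: "nat \<Rightarrow> real" and \<epsilon> :: "nat \<Rightarrow> int" and n :: nat
  defines "g \<equiv> \<lambda>i j. exp (class_score (ln (20 * real n)) (t i) (t j))"
  assumes N: "finite N" "card N \<le> n" and "n > 0"
    and \<epsilon>: "\<And>j. j \<in> insert i N \<Longrightarrow> \<epsilon> j \<in> {-1, 0, 1}"
    and t: "\<And>j. j \<in> insert i N \<Longrightarrow> \<bar>t j - of_int (\<epsilon> j)\<bar> < 1/10"
    and hits: "j\<^sub>1 \<in> N" "j\<^sub>2 \<in> N" "j\<^sub>1 \<noteq> j\<^sub>2" "\<epsilon> j\<^sub>1 = 1" "\<epsilon> j\<^sub>2 = 1"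
  shows "(\<Sum>j\<in>N. g i j / (\<Sum>l\<in>insert i N. g i l) * t j) < 1/2 \<longleftrightarrow> \<epsilon> i = 0"
proof -
  define D where "D = (\<Sum>l\<in>insert i N. g i l)"
  define E where "E = 20 * real n"
  have E: "E \<ge> 20" "exp (ln (20 * real n)) = E"
    using \<open>n > 0\<close> by (auto simp: E_def)
  have g: "g i j = (if (if \<epsilon> i = 0 then \<epsilon> j = 0 else \<epsilon> j = 1) then E else 1)"
    if "j \<in> insert i N" for j
  proof -
    have cls: "\<bar>t j\<bar> < 1/2 \<longleftrightarrow> \<epsilon> j = 0" "t j \<ge> 1/2 \<longleftrightarrow> \<epsilon> j = 1" if "j \<in> insert i N" for j
      using \<epsilon> [OF that] t [OF that] by (auto simp: abs_if split: if_splits)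
    show ?thesis
      using cls [of i] cls [OF that] E(2) by (simp add: g_def class_score_def)
  qed
  have gpos: "g i j > 0" for j
    by (simp add: g_def)
  \<comment> \<open>Bounds rather than an identity, because \<open>i\<close> is not assumed to lie
    outside \<open>N\<close>.\<close>
  have D: "g i i \<le> D" "(\<Sum>l\<in>N. g i l) \<le> D" "D \<le> g i i + (\<Sum>l\<in>N. g i l)"
    using N(1) gpos
    by (auto simp: D_def sum.insert_if less_imp_le intro!: member_le_sum sum_nonneg)
  have "D > 0"
    using D(1) gpos [of i] by linarith
  have est: "(\<Sum>j\<in>N. g i j / D * t j) = (\<Sum>j\<in>N. g i j * t j) / D"
    by (simp add: sum_divide_distrib)
  have cardN: "real (card N) \<le> E / 20"
    using N by (simp add: E_def)
  show ?thesis
  proof (cases "\<epsilon> i = 0")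
    case True
    \<comment> \<open>A neighbour of class 0 has \<open>t j < 1/10\<close>; any other has weight 1
      and \<open>t j < 11/10\<close>. Since \<open>D \<ge> g i i = E\<close>, the total is at most
      \<open>D / 10 + 11/200 * D\<close>, well below \<open>D / 2\<close>.\<close>
    have "g i j * t j \<le> g i j / 10 + 11/10" if "j \<in> N" for j
    proof (cases "\<epsilon> j = 0")
      case j0: True
      then have "g i j * t j \<le> g i j * (1/10)"
        using t [of j] that gpos [of j] by (intro mult_left_mono) (auto simp: abs_less_iff)
      then show ?thesis by simp
    qed (use \<epsilon> [of j] t [of j] that True in \<open>auto simp: g abs_if split: if_splits\<close>)
    then have "(\<Sum>j\<in>N. g i j * t j) \<le> (\<Sum>j\<in>N. g i j / 10 + 11/10)"
      by (intro sum_mono)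
    also have "\<dots> = (\<Sum>j\<in>N. g i j) / 10 + 11/10 * real (card N)"
      by (simp add: sum.distrib sum_divide_distrib)
    also have "\<dots> < D / 2"
      using D cardN E True by (simp add: g)
    finally show ?thesis
      using True \<open>D > 0\<close> unfolding D_def [symmetric] est by (simp add: pos_divide_less_eq)
  next
    case False
    \<comment> \<open>The contributions are measured relative to the threshold 1/2. A hit has
      \<open>t j > 9/10\<close> and so gains at least \<open>2/5 * E\<close>. Two hits less a total
      loss of \<open>8/5 * (E / 20)\<close> leave \<open>18/25 * E\<close>, which exceeds the
      \<open>E / 2\<close> needed to absorb \<open>g i i / 2\<close>; one hit would leave only
      \<open>8/25 * E\<close>.\<close>
    have big: "g i j * (t j - 1/2) \<ge> 2/5 * E" if "j \<in> N" "\<epsilon> j = 1" for j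
    proof -
      have "E * (2/5) \<le> E * (t j - 1/2)"
        using t [of j] that E(1) by (intro mult_left_mono) (auto simp: abs_if split: if_splits)
      then show ?thesis using that False by (simp add: g)
    qed
    \<comment> \<open>The worst case is a neighbour of class -1, with weight 1 and
      \<open>t j > - 11/10\<close>.\<close>
    have small: "g i j * (t j - 1/2) \<ge> - 8/5" if "j \<in> N" for j
    proof (cases "\<epsilon> j = 1")
      case True
      then show ?thesis using big [OF that] E by linarith
    qed (use \<epsilon> [of j] t [of j] that False in \<open>auto simp: g abs_if split: if_splits\<close>)
    have "(\<Sum>j\<in>N. g i j * (t j - 1/2)) =
        (\<Sum>j\<in>N - {j\<^sub>1, j\<^sub>2}. g i j * (t j - 1/2)) + (\<Sum>j\<in>{j\<^sub>1, j\<^sub>2}. g i j * (t j - 1/2))"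
      using N hits by (intro sum.subset_diff) auto
    moreover have "(\<Sum>j\<in>N - {j\<^sub>1, j\<^sub>2}. g i j * (t j - 1/2)) \<ge> (\<Sum>j\<in>N - {j\<^sub>1, j\<^sub>2}. - 8/5)"
      using small by (intro sum_mono) auto
    moreover have "(\<Sum>j\<in>N - {j\<^sub>1, j\<^sub>2}. - 8/5 :: real) \<ge> - 8/5 * (E / 20)"
      using card_mono [OF N(1), of "N - {j\<^sub>1, j\<^sub>2}"] cardN by auto
    moreover have "(\<Sum>j\<in>{j\<^sub>1, j\<^sub>2}. g i j * (t j - 1/2)) \<ge> 4/5 * E"
      using big [of j\<^sub>1] big [of j\<^sub>2] hits by simp
    moreover have "(\<Sum>j\<in>N. g i j * (t j - 1/2)) = (\<Sum>j\<in>N. g i j * t j) - (\<Sum>j\<in>N. g i j) / 2"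
      by (simp add: algebra_simps sum_subtractf sum_divide_distrib)
    moreover have "g i i \<le> E"
      using E by (simp add: g)
    ultimately have "(\<Sum>j\<in>N. g i j * t j) \<ge> D / 2"
      using D E by linarith
    then show ?thesis
      using False \<open>D > 0\<close> unfolding D_def [symmetric] est by (simp add: pos_divide_less_eq)
  qed
qed

definition projection_score :: "nat \<Rightarrow> nat \<Rightarrow> rvec \<Rightarrow> rvec \<Rightarrow> rvec \<Rightarrow> real" where
  "projection_score n d \<mu> h h' = class_score (ln (20 * real n))
     (inner_prod d (\<lambda>k. \<mu> k / (vnorm d \<mu>)\<^sup>2) h) (inner_prod d (\<lambda>k. \<mu> k / (vnorm d \<mu>)\<^sup>2) h')"

text \<open>The score sees a feature vector only through one linear functional, so a matrix with the
  single row \<open>\<mu> k / (vnorm d \<mu>)\<^sup>2\<close> suffices and \<alpha> reads coordinate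
  0.\<close>

lemma attention_architecture_projection_score:
  "attention_architecture d (projection_score n d \<mu>)"
  unfolding attention_architecture_def
  by (intro exI [of _ 1] exI [of _ "\<lambda>_ k. \<mu> k / (vnorm d \<mu>)\<^sup>2"]
      exI [of _ "\<lambda>v v'. class_score (ln (20 * real n)) (v 0) (v' 0)"])
    (simp add: projection_score_def mat_vec_def)

text \<open>Each summand contains \<open>vnorm d \<mu> * t X j\<close> and the bias is
  \<open>- vnorm d \<mu> / 2\<close>, so the estimator is negative exactly when the attention
  average of the \<open>t X j\<close> over the neighbours is below 1/2.\<close>

lemma gat_estimator_projection_score:
  fixes \<mu> :: rvec and \<epsilon> :: "nat \<Rightarrow> int" and d :: nat
  defines "t \<equiv> \<lambda>X j. inner_prod d (\<lambda>k. \<mu> k / (vnorm d \<mu>)\<^sup>2) (X j)"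
  assumes "vnorm d \<mu> > 0" "i < n"
    and \<epsilon>: "\<And>j. j < n \<Longrightarrow> \<epsilon> j \<in> {-1, 0, 1}"
    and t: "\<And>j. j < n \<Longrightarrow> \<bar>t X j - of_int (\<epsilon> j)\<bar> < 1/10"
    and hits: "\<And>H. H \<in> {{..<n div 2}, {n div 2..<n}} \<Longrightarrow> \<exists>j\<in>H - {i}. \<epsilon> j = 1 \<and> A i j"
  shows "gat_estimator n d (projection_score n d \<mu>)
      (\<lambda>k. \<mu> k / vnorm d \<mu>) (- vnorm d \<mu> / 2) X A i < 0 \<longleftrightarrow> i \<in> community n \<epsilon> 0"
proof -
  let ?N = "neighbours n A i"
  let ?c = "attention_coeff n (projection_score n d \<mu>) X A i"
  \<comment> \<open>The halves are disjoint, so hits taken from each of them are automatically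
    distinct.\<close>
  obtain j\<^sub>1 where j1: "j\<^sub>1 < n div 2" "\<epsilon> j\<^sub>1 = 1" "A i j\<^sub>1"
    using hits [of "{..<n div 2}"] by fastforce
  obtain j\<^sub>2 where j2: "n div 2 \<le> j\<^sub>2" "j\<^sub>2 < n" "\<epsilon> j\<^sub>2 = 1" "A i j\<^sub>2"
    using hits [of "{n div 2..<n}"] by fastforce
  have N: "?N \<subseteq> {..<n}"
    by (auto simp: neighbours_def)
  have t_eq: "inner_prod d (\<lambda>k. \<mu> k / (vnorm d \<mu>)\<^sup>2) (X j) = t X j" for j
    by (simp add: t_def)
  have "(\<Sum>j\<in>?N. ?c j * t X j) < 1/2 \<longleftrightarrow> \<epsilon> i = 0"
    unfolding attention_coeff_def projection_score_def t_eq
  proof (rule class_score_attention)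
    show "finite ?N"
      using N finite_subset by blast
    show "card ?N \<le> n"
      using card_mono [OF _ N] by simp
    show "j\<^sub>1 \<in> ?N" "j\<^sub>2 \<in> ?N" "j\<^sub>1 \<noteq> j\<^sub>2"
      using j1 j2 by (auto simp: neighbours_def)
  qed (use assms N j1 j2 in auto)
  moreover have "inner_prod d (\<lambda>k. \<mu> k / vnorm d \<mu>) (X j) = vnorm d \<mu> * t X j" for j
    using assms(2) by (simp add: inner_prod_def t_def sum_distrib_left power2_eq_square)
  then have "gat_estimator n d (projection_score n d \<mu>)
      (\<lambda>k. \<mu> k / vnorm d \<mu>) (- vnorm d \<mu> / 2) X A i = vnorm d \<mu> * ((\<Sum>j\<in>?N. ?c j * t X j) - 1/2)"
    by (simp add: gat_estimator_def sum_distrib_left algebra_simps)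
  ultimately show ?thesis
    using assms(2,3) by (simp add: community_def mult_less_0_iff)
qed

section \<open>Integration and measurability for the joint law\<close>

text \<open>One \<sigma>-algebra shared by the conditional laws for all labels, as the monadic bind
  in \<open>csbm\<close> requires.\<close>

abbreviation csbm_space ::
    "nat \<Rightarrow> nat \<Rightarrow> ((nat \<Rightarrow> int) \<times> (nat \<Rightarrow> rvec) \<times> (nat \<Rightarrow> nat \<Rightarrow> bool)) measure" where
  "csbm_space n d \<equiv> count_space UNIV \<Otimes>\<^sub>M
     (Pi\<^sub>M {..<n} (\<lambda>_. Pi\<^sub>M {..<d} (\<lambda>_. borel)) \<Otimes>\<^sub>M count_space UNIV)"

lemma sets_csbm_kernel:
  "sets (return (count_space UNIV) \<epsilon> \<Otimes>\<^sub>M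
      (feature_measure n d \<mu> \<sigma> \<epsilon> \<Otimes>\<^sub>M measure_pmf (adjacency_pmf n p q \<epsilon>))) = sets (csbm_space n d)"
  by (intro sets_pair_measure_cong sets_feature_measure) auto

text \<open>The labels live on a discrete space, from which every map is measurable; it remains to
  see that each value is a probability measure on the common space.\<close>

lemma measurable_csbm_kernel:
  assumes "\<sigma> > 0"
  shows "(\<lambda>\<epsilon>. return (count_space UNIV) \<epsilon> \<Otimes>\<^sub>M
      (feature_measure n d \<mu> \<sigma> \<epsilon> \<Otimes>\<^sub>M measure_pmf (adjacency_pmf n p q \<epsilon>)))
    \<in> measure_pmf (class_pmf n) \<rightarrow>\<^sub>M prob_algebra (csbm_space n d)"
proof -
  have "prob_space (return (count_space UNIV) \<epsilon> \<Otimes>\<^sub>M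
      (feature_measure n d \<mu> \<sigma> \<epsilon> \<Otimes>\<^sub>M measure_pmf (adjacency_pmf n p q \<epsilon>)))" for \<epsilon>
    using assms by (intro prob_space_pair prob_space_return prob_space_feature_measure
        measure_pmf.prob_space_axioms) auto
  then show ?thesis
    by (simp add: space_prob_algebra sets_csbm_kernel)
qed

lemma sets_csbm: "\<sigma> > 0 \<Longrightarrow> sets (csbm n d p q \<mu> \<sigma>) = sets (csbm_space n d)"
  unfolding csbm_def
  by (rule sets_bind' [OF _ measurable_csbm_kernel])
    (simp_all add: space_prob_algebra measure_pmf.prob_space_axioms)

lemma prob_space_csbm: "\<sigma> > 0 \<Longrightarrow> prob_space (csbm n d p q \<mu> \<sigma>)"
  unfolding csbm_def
  by (rule prob_space_bind' [OF _ measurable_csbm_kernel])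
    (simp_all add: space_prob_algebra measure_pmf.prob_space_axioms)

text \<open>Tonelli's theorem for the conditional product law, where the point mass at \<epsilon>
  collapses the label component.\<close>

lemma emeasure_csbm:
  assumes "\<sigma> > 0" and B [measurable]: "B \<in> sets (csbm_space n d)"
  shows "emeasure (csbm n d p q \<mu> \<sigma>) B =
    (\<integral>\<^sup>+\<epsilon>. \<integral>\<^sup>+X. \<integral>\<^sup>+A. indicator B (\<epsilon>, X, A) \<partial>measure_pmf (adjacency_pmf n p q \<epsilon>)
      \<partial>feature_measure n d \<mu> \<sigma> \<epsilon> \<partial>measure_pmf (class_pmf n))"
proof -
  have "emeasure (return (count_space UNIV) \<epsilon> \<Otimes>\<^sub>M
      (feature_measure n d \<mu> \<sigma> \<epsilon> \<Otimes>\<^sub>M measure_pmf (adjacency_pmf n p q \<epsilon>))) B =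
    (\<integral>\<^sup>+X. \<integral>\<^sup>+A. indicator B (\<epsilon>, X, A) \<partial>measure_pmf (adjacency_pmf n p q \<epsilon>)
      \<partial>feature_measure n d \<mu> \<sigma> \<epsilon>)" for \<epsilon>
  proof -
    let ?F = "feature_measure n d \<mu> \<sigma> \<epsilon>" and ?A = "measure_pmf (adjacency_pmf n p q \<epsilon>)"
    interpret FA: prob_space "?F \<Otimes>\<^sub>M ?A"
      using assms by (intro prob_space_pair prob_space_feature_measure
          measure_pmf.prob_space_axioms)
    have "emeasure (return (count_space UNIV) \<epsilon> \<Otimes>\<^sub>M (?F \<Otimes>\<^sub>M ?A)) B =
        (\<integral>\<^sup>+e. \<integral>\<^sup>+y. indicator B (e, y) \<partial>(?F \<Otimes>\<^sub>M ?A) \<partial>return (count_space UNIV) \<epsilon>)"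
      using B by (intro FA.emeasure_pair_measure) (simp only: sets_csbm_kernel)
    also have "\<dots> = (\<integral>\<^sup>+y. indicator B (\<epsilon>, y) \<partial>(?F \<Otimes>\<^sub>M ?A))"
      by (subst nn_integral_return) auto
    also have "\<dots> = (\<integral>\<^sup>+X. \<integral>\<^sup>+A. indicator B (\<epsilon>, X, A) \<partial>?A \<partial>?F)"
      by (rule measure_pmf.nn_integral_fst [symmetric]) measurable
    finally show ?thesis .
  qed
  then show ?thesis
    unfolding csbm_def
    using emeasure_bind [OF _ measurable_prob_algebraD [OF measurable_csbm_kernel [OF assms(1)]] B]
    by simp
qed

lemma measurable_separation_event:
  "{\<omega> \<in> space (csbm_space n d). case \<omega> of (\<epsilon>, X, A) \<Rightarrow>
      \<forall>i<n. gat_estimator n d (projection_score n d \<mu>) w b X A i < 0 \<longleftrightarrow> i \<in> community n \<epsilon> 0}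
    \<in> sets (csbm_space n d)"
proof -
  let ?g = "\<lambda>X i j. exp (projection_score n d \<mu> (X i) (X j))"
  \<comment> \<open>The neighbourhood depends on the outcome. Sums over the fixed index set
    \<open>{..<n}\<close> with a case distinction on the edges make measurability a matter of finite
    sums.\<close>
  have expand: "gat_estimator n d (projection_score n d \<mu>) w b X A i =
      (\<Sum>j<n. if A i j then ?g X i j / (\<Sum>l<n. if l = i \<or> A i l then ?g X i l else 0) *
        inner_prod d w (X j) else 0) + b" if "i < n" for X A i
  proof -
    have "neighbours n A i = {j\<in>{..<n}. A i j}"
      by (auto simp: neighbours_def)
    moreover have "insert i (neighbours n A i) = {l\<in>{..<n}. l = i \<or> A i l}"
      using that by (auto simp: neighbours_def)
    ultimately show ?thesis
      by (simp add: gat_estimator_def attention_coeff_def flip: sum.inter_filter)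
  qed
  have [measurable]: "(\<lambda>\<omega>. ?g (fst (snd \<omega>)) i j) \<in> borel_measurable (csbm_space n d)"
    if [simp]: "i < n" "j < n" for i j
    unfolding projection_score_def class_score_def by measurable
  have [measurable]: "(\<lambda>\<omega>. inner_prod d w (fst (snd \<omega>) j)) \<in> borel_measurable (csbm_space n d)"
    if [simp]: "j < n" for j
    by measurable
  have [measurable]: "Measurable.pred (csbm_space n d) (\<lambda>\<omega>. snd (snd \<omega>) i j)" for i j
    by (rule measurable_compose [of "\<lambda>\<omega>. snd (snd \<omega>)" _ "count_space UNIV"]) measurable
  have [measurable]: "Measurable.pred (csbm_space n d) (\<lambda>\<omega>. fst \<omega> i = 0)" for i
    by (rule measurable_compose [of fst _ "count_space UNIV"]) measurable
  have "Measurable.pred (csbm_space n d) (\<lambda>\<omega>. \<forall>i\<in>{..<n}.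
      (\<Sum>j<n. if snd (snd \<omega>) i j
        then ?g (fst (snd \<omega>)) i j /
          (\<Sum>l<n. if l = i \<or> snd (snd \<omega>) i l then ?g (fst (snd \<omega>)) i l else 0) *
          inner_prod d w (fst (snd \<omega>) j) else 0) + b < 0 \<longleftrightarrow> fst \<omega> i = 0)"
    by measurable
  then show ?thesis
    by (simp add: case_prod_beta pred_def expand community_def cong: conj_cong)
qed

section \<open>The bound for fixed n and the limit\<close>

text \<open>Separation can fail only if some projection is far from its label or some node misses
  class 1 in one half. The first error term bounds the former for every labelling, the second bounds
  the latter on average over the labels.\<close>

lemma csbm_separation_prob:
  assumes "\<sigma> > 0" "vnorm d \<mu> > 0"
    and r: "0 \<le> r" "r \<le> p" "r \<le> q" "p \<le> 1" "q \<le> 1"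
  shows "\<P>((\<epsilon>, X, A) in csbm n d p q \<mu> \<sigma>.
      \<forall>i<n. gat_estimator n d (projection_score n d \<mu>)
          (\<lambda>k. \<mu> k / vnorm d \<mu>) (- vnorm d \<mu> / 2) X A i < 0 \<longleftrightarrow> i \<in> community n \<epsilon> 0)
    \<ge> 1 - (2 * real n * exp (- (1/10)\<^sup>2 * (vnorm d \<mu>)\<^sup>2 / (2 * \<sigma>\<^sup>2))
          + 2 * real n * (1 - r / 3) ^ (n div 2 - 1))"
proof -
  let ?M = "csbm n d p q \<mu> \<sigma>"
  let ?F = "feature_measure n d \<mu> \<sigma>" and ?A = "\<lambda>\<epsilon>. measure_pmf (adjacency_pmf n p q \<epsilon>)"
  let ?P = "\<lambda>\<epsilon> X A. \<forall>i<n. gat_estimator n d (projection_score n d \<mu>)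
    (\<lambda>k. \<mu> k / vnorm d \<mu>) (- vnorm d \<mu> / 2) X A i < 0 \<longleftrightarrow> i \<in> community n \<epsilon> 0"
  let ?G = "{(\<epsilon>, X, A). (\<epsilon>, X, A) \<in> space ?M \<and> ?P \<epsilon> X A}"
  let ?w = "\<lambda>k. \<mu> k / (vnorm d \<mu>)\<^sup>2"
  define b1 where "b1 = 2 * real n * exp (- (1/10)\<^sup>2 * (vnorm d \<mu>)\<^sup>2 / (2 * \<sigma>\<^sup>2))"
  define b2 where "b2 = 2 * real n * (1 - r / 3) ^ (n div 2 - 1)"
  define noisy where "noisy \<epsilon> =
    {X \<in> space (?F \<epsilon>). \<exists>i<n. \<bar>inner_prod d ?w (X i) - of_int (\<epsilon> i)\<bar> \<ge> 1/10}"
    for \<epsilon> :: "nat \<Rightarrow> int"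
  define sparse where "sparse \<epsilon> =
    {A. \<exists>i<n. \<exists>H\<in>{{..<n div 2}, {n div 2..<n}}. \<forall>j\<in>H - {i}. \<epsilon> j = 1 \<longrightarrow> \<not> A i j}"
    for \<epsilon> :: "nat \<Rightarrow> int"
  have b: "b1 \<ge> 0" "b2 \<ge> 0"
    using r by (auto simp: b1_def b2_def)
  interpret M: prob_space ?M
    using assms(1) by (rule prob_space_csbm)
  note sets_M = sets_csbm [OF assms(1), of n d p q \<mu>]
  note space_M = sets_eq_imp_space_eq [OF sets_M]
  have G: "?G \<in> sets ?M"
  proof -
    have "?G = {\<omega> \<in> space (csbm_space n d). case \<omega> of (\<epsilon>, X, A) \<Rightarrow> ?P \<epsilon> X A}"
      by (simp only: space_M case_prod_unfold prod.collapse)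
    then show ?thesis
      by (simp only: sets_M measurable_separation_event)
  qed
  have noisy_sets [measurable]: "noisy \<epsilon> \<in> sets (?F \<epsilon>)" for \<epsilon>
    unfolding noisy_def by measurable
  have noisy_le: "emeasure (?F \<epsilon>) (noisy \<epsilon>) \<le> ennreal b1" for \<epsilon>
    unfolding noisy_def b1_def using assms by (intro feature_measure_tail) auto
  \<comment> \<open>The labels are restricted to the support of their law because the deterministic
    argument needs them in \<open>{-1, 0, 1}\<close>. The sum of indicators separates features from
    graph, so each inner integral can be evaluated on its own.\<close>
  have bad: "indicator (space ?M - ?G) (\<epsilon>, X, A) \<le>
      (indicator (noisy \<epsilon>) X + indicator (sparse \<epsilon>) A :: ennreal)"
    if "\<epsilon> \<in> set_pmf (class_pmf n)" "X \<in> space (?F \<epsilon>)" for \<epsilon> X A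
  proof (cases "X \<in> noisy \<epsilon> \<or> A \<in> sparse \<epsilon>")
    case False
    have "?P \<epsilon> X A"
    proof (intro allI impI gat_estimator_projection_score)
      fix j assume "j < n"
      then show "\<epsilon> j \<in> {-1, 0, 1}"
        using that(1) by (auto simp: class_pmf_def set_Pi_pmf PiE_dflt_def)
      show "\<bar>inner_prod d ?w (X j) - of_int (\<epsilon> j)\<bar> < 1/10"
        using False \<open>j < n\<close> that(2) by (force simp: noisy_def not_le)
    next
      fix i H assume "i < n" "H \<in> {{..<n div 2}, {n div 2..<n}}"
      then show "\<exists>j\<in>H - {i}. \<epsilon> j = 1 \<and> A i j"
        using False unfolding sparse_def by blast
    qed (use assms in auto)
    then show ?thesis
      by (auto simp: indicator_def)
  qed (auto simp: indicator_def)
  have "emeasure ?M (space ?M - ?G) =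
      (\<integral>\<^sup>+\<epsilon>. \<integral>\<^sup>+X. \<integral>\<^sup>+A. indicator (space ?M - ?G) (\<epsilon>, X, A) \<partial>?A \<epsilon> \<partial>?F \<epsilon> \<partial>measure_pmf (class_pmf n))"
    using sets.compl_sets [OF G] unfolding sets_M by (rule emeasure_csbm [OF assms(1)])
  also have "\<dots> \<le> (\<integral>\<^sup>+\<epsilon>. ennreal b1 + emeasure (?A \<epsilon>) (sparse \<epsilon>) \<partial>measure_pmf (class_pmf n))"
  proof (intro nn_integral_mono_AE AE_pmfI)
    fix \<epsilon> assume \<epsilon>: "\<epsilon> \<in> set_pmf (class_pmf n)"
    interpret F: prob_space "?F \<epsilon>"
      using assms(1) by (rule prob_space_feature_measure)
    have "(\<integral>\<^sup>+X. \<integral>\<^sup>+A. indicator (space ?M - ?G) (\<epsilon>, X, A) \<partial>?A \<epsilon> \<partial>?F \<epsilon>)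
        \<le> (\<integral>\<^sup>+X. \<integral>\<^sup>+A. indicator (noisy \<epsilon>) X + indicator (sparse \<epsilon>) A \<partial>?A \<epsilon> \<partial>?F \<epsilon>)"
      using bad [OF \<epsilon>] by (intro nn_integral_mono) auto
    also have "\<dots> = (\<integral>\<^sup>+X. indicator (noisy \<epsilon>) X + emeasure (?A \<epsilon>) (sparse \<epsilon>) \<partial>?F \<epsilon>)"
      by (subst nn_integral_add) (simp_all add: measure_pmf.emeasure_space_1)
    also have "\<dots> = emeasure (?F \<epsilon>) (noisy \<epsilon>) + emeasure (?A \<epsilon>) (sparse \<epsilon>)"
      by (subst nn_integral_add) (simp_all add: F.emeasure_space_1)
    also have "\<dots> \<le> ennreal b1 + emeasure (?A \<epsilon>) (sparse \<epsilon>)"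
      by (intro add_right_mono noisy_le)
    finally show "(\<integral>\<^sup>+X. \<integral>\<^sup>+A. indicator (space ?M - ?G) (\<epsilon>, X, A) \<partial>?A \<epsilon> \<partial>?F \<epsilon>)
        \<le> ennreal b1 + emeasure (?A \<epsilon>) (sparse \<epsilon>)" .
  qed
  also have "\<dots> = ennreal b1 + (\<integral>\<^sup>+\<epsilon>. emeasure (?A \<epsilon>) (sparse \<epsilon>) \<partial>measure_pmf (class_pmf n))"
    by (subst nn_integral_add) (simp_all add: measure_pmf.emeasure_space_1)
  also have "\<dots> \<le> ennreal b1 + ennreal b2"
    unfolding sparse_def b2_def by (intro add_left_mono adjacency_pmf_no_hit r)
  also have "\<dots> = ennreal (b1 + b2)"
    using b by simp
  finally have "measure ?M (space ?M - ?G) \<le> b1 + b2"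
    using b by (simp add: M.emeasure_eq_measure del: ennreal_plus)
  then show ?thesis
    using M.prob_compl [OF G] unfolding b1_def b2_def by linarith
qed

theorem theorem1:
  fixes d :: "nat \<Rightarrow> nat" and p q \<sigma> :: "nat \<Rightarrow> real" and \<mu> :: "nat \<Rightarrow> nat \<Rightarrow> real"
  assumes "\<And>n. p n \<in> {0..1}" and "\<And>n. q n \<in> {0..1}" and "\<And>n. \<sigma> n > 0"
    and "p \<in> \<Omega>(\<lambda>n. (ln (real n))\<^sup>2 / real n)"
    and "q \<in> \<Omega>(\<lambda>n. (ln (real n))\<^sup>2 / real n)"
    and "filterlim (\<lambda>n. vnorm (d n) (\<mu> n) / (\<sigma> n * sqrt (ln (real n)))) at_top sequentially"
  shows "\<exists>\<Psi>. (\<forall>n. attention_architecture (d n) (\<Psi> n)) \<and>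
    (\<lambda>n. \<P>((\<epsilon>, X, A) in csbm n (d n) (p n) (q n) (\<mu> n) (\<sigma> n).
        \<forall>i<n. gat_estimator n (d n) (\<Psi> n)
                (\<lambda>k. \<mu> n k / vnorm (d n) (\<mu> n)) (- vnorm (d n) (\<mu> n) / 2) X A i < 0
              \<longleftrightarrow> i \<in> community n \<epsilon> 0))
      \<longlonglongrightarrow> 1"
proof (intro exI [of _ "\<lambda>n. projection_score n (d n) (\<mu> n)"] conjI allI
    attention_architecture_projection_score)
  let ?v = "\<lambda>n. vnorm (d n) (\<mu> n)"
  let ?\<P> = "\<lambda>n. \<P>((\<epsilon>, X, A) in csbm n (d n) (p n) (q n) (\<mu> n) (\<sigma> n).
    \<forall>i<n. gat_estimator n (d n) (projection_score n (d n) (\<mu> n))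
      (\<lambda>k. \<mu> n k / ?v n) (- ?v n / 2) X A i < 0 \<longleftrightarrow> i \<in> community n \<epsilon> 0)"
  from assms(4) obtain c\<^sub>p where cp: "c\<^sub>p > 0"
    "eventually (\<lambda>n. norm (p n) \<ge> c\<^sub>p * norm ((ln (real n))\<^sup>2 / real n)) sequentially"
    by (elim landau_omega.bigE)
  from assms(5) obtain c\<^sub>q where cq: "c\<^sub>q > 0"
    "eventually (\<lambda>n. norm (q n) \<ge> c\<^sub>q * norm ((ln (real n))\<^sup>2 / real n)) sequentially"
    by (elim landau_omega.bigE)
  define c where "c = min c\<^sub>p c\<^sub>q"
  have c: "c > 0" "c \<le> c\<^sub>p" "c \<le> c\<^sub>q"
    using cp cq by (auto simp: c_def)
  \<comment> \<open>The two error terms after inserting the growth assumptions: the first equals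
    \<open>2 / n\<close>, and in the second the squared logarithm beats the factor
    \<open>n\<close>.\<close>
  define L where "L n = 1 - (2 * real n * exp (- 2 * ln (real n))
    + 2 * real n * exp (- (c / 12) * (ln (real n))\<^sup>2))" for n
  have "L \<longlonglongrightarrow> 1"
    unfolding L_def using c(1) by real_asymp
  \<comment> \<open>The ratio 20 makes the Gaussian exponent at least
    \<open>(1/10)\<^sup>2 * 20\<^sup>2 / 2 = 2\<close> times \<open>ln (real n)\<close>. From
    \<open>n = 6\<close> on, \<open>n div 2 - 1\<close> is at least \<open>n / 4\<close>.\<close>
  moreover have "eventually (\<lambda>n. L n \<le> ?\<P> n) sequentially"
    using cp(2) cq(2) filterlim_at_top_dense [THEN iffD1, OF assms(6), rule_format, of 20]
      eventually_ge_at_top [of 6]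
  proof eventually_elim
    case (elim n)
    \<comment> \<open>A common lower bound for both edge probabilities, since \<open>c\<close> is
      the smaller of the two constants.\<close>
    define r where "r = c * ((ln (real n))\<^sup>2 / real n)"
    have "r \<le> c\<^sub>p * ((ln (real n))\<^sup>2 / real n)" "r \<le> c\<^sub>q * ((ln (real n))\<^sup>2 / real n)"
      unfolding r_def using c by (intro mult_right_mono; simp)+
    then have r: "0 \<le> r" "r \<le> p n" "r \<le> q n" "p n \<le> 1" "q n \<le> 1"
      using elim assms(1,2) [of n] c by (auto simp: r_def)
    have lnn: "ln (real n) > 0"
      using elim by simp
    then have v: "?v n > 20 * (\<sigma> n * sqrt (ln (real n)))"
      using elim assms(3) [of n] by (simp add: field_simps)
    moreover have s: "\<sigma> n * sqrt (ln (real n)) > 0"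
      using lnn assms(3) by simp
    ultimately have vpos: "?v n > 0"
      by linarith
    have "(20 * (\<sigma> n * sqrt (ln (real n))))\<^sup>2 \<le> (?v n)\<^sup>2"
      using v s by (intro power_mono) auto
    then have "400 * (\<sigma> n)\<^sup>2 * ln (real n) \<le> (?v n)\<^sup>2"
      using lnn by (simp add: power_mult_distrib)
    then have "2 * ln (real n) \<le> (1/10)\<^sup>2 * (?v n)\<^sup>2 / (2 * (\<sigma> n)\<^sup>2)"
      using assms(3) [of n] by (simp add: field_simps power2_eq_square)
    then have b1: "2 * real n * exp (- (1/10)\<^sup>2 * (?v n)\<^sup>2 / (2 * (\<sigma> n)\<^sup>2))
        \<le> 2 * real n * exp (- 2 * ln (real n))"
      by (intro mult_left_mono) auto
    \<comment> \<open>By \<open>1 - x \<le> exp (- x)\<close>. The constant \<open>c / 12\<close>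
      below is 1/3 from the chance of class 1 times 1/4 from the size of a half.\<close>
    have "(1 - r / 3) ^ (n div 2 - 1) \<le> exp (- (r / 3)) ^ (n div 2 - 1)"
      using exp_ge_add_one_self [of "- (r / 3)"] r by (intro power_mono) auto
    also have "\<dots> = exp (- (r / 3) * real (n div 2 - 1))"
      by (subst mult.commute) (rule exp_of_nat_mult [symmetric])
    also have "\<dots> \<le> exp (- (c / 12) * (ln (real n))\<^sup>2)"
    proof -
      have "real n / 4 \<le> real (n div 2 - 1)"
        using elim by linarith
      then have "r / 3 * (real n / 4) \<le> r / 3 * real (n div 2 - 1)"
        using r by (intro mult_left_mono) auto
      moreover have "r / 3 * (real n / 4) = c / 12 * (ln (real n))\<^sup>2"
        using elim by (simp add: r_def)
      ultimately show ?thesis by simp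
    qed
    finally have b2: "2 * real n * (1 - r / 3) ^ (n div 2 - 1)
        \<le> 2 * real n * exp (- (c / 12) * (ln (real n))\<^sup>2)"
      by (intro mult_left_mono) auto
    show ?case
      using csbm_separation_prob [OF assms(3) [of n] vpos r, of n] b1 b2 unfolding L_def by linarith
  qed
  moreover have "eventually (\<lambda>n. ?\<P> n \<le> 1) sequentially"
    using assms(3) by (intro always_eventually allI prob_space.prob_le_1 prob_space_csbm)
  ultimately show "?\<P> \<longlonglongrightarrow> 1"
    by (intro tendsto_sandwich [of L ?\<P> _ "\<lambda>_. 1"]) auto
qed

end
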